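(* For $\epsilon\in(0,1]$ let $P_\epsilon:H\to EA$ be defined by $$P_\epsilon(x,(y,z))=\Big(e^{-\epsilon x},\ z\,\frac{e^{-\epsilon x}-1}{-\epsilon x},\ z+\epsilon\big(y-\tfrac{xz}{2}\big)\Big)\quad (x\neq0),\qquad P_\epsilon(0,(y,z))=(1,\ z,\ z+\epsilon y).$$ Then $P_\epsilon$ realizes the contraction of $EA$ to $H$; that is, each $P_\epsilon$ is a diffeomorphism from $H$ onto $EA$ mapping the identity of $H$ to the identity of $EA$, and for all $g,h\in H$ $$g\cdot h=\lim_{\epsilon\to0^+}P_\epsilon^{-1}\big(P_\epsilon(g)\cdot P_\epsilon(h)\big),$$ where the product on the left is that of $H$ and the product inside the limit is that of $EA$.
   Context: Heisenberg group $H$: the manifold $\mathbb{R}\times\mathbb{R}^2$ with product $(x_1,(y_1,z_1))(x_2,(y_2,z_2))=(x_1+x_2,\,(y_1+y_2+x_1z_2,\ z_1+z_2))$ (it is the semidirect product $\mathbb{R}^2\rtimes_\varphi\mathbb{R}$ with $\varphi_\alpha(x_1,x_2)=(x_1+\alpha x_2,x_2)$). Extended affine group $EA$: the manifold $\mathbb{R}^+\times\mathbb{R}\times\mathbb{R}$ with product $(\alpha,\beta,\gamma)(x,y,z)=(\alpha x,\alpha y+\beta,\gamma+z)$. A Lie group $G_0$ is the contraction of a Lie group $G_1$ by diffeomorphisms $P_\epsilon:G_0\to G_1$, $\epsilon\in(0,1]$, if each $P_\epsilon$ preserves the identity element and $g\cdot h=\lim_{\epsilon\to0^+}P_\epsilon^{-1}(P_\epsilon(g)\cdot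 P_\epsilon(h))$ for all $g,h\in G_0$. *)

theory Defs
  imports "HOL-Analysis.Analysis" "HOL-Algebra.Group"
begin

text \<open>In finite dimension, continuity of all the directional
  derivatives \<open>\<lambda>x. frechet_derivative f (at x) v\<close> is continuity of the derivative itself.
  The derivatives are two-sided, so the notion is meant for open \<open>S\<close> only.\<close>

primrec Ck_on :: "nat \<Rightarrow> 'a::euclidean_space set \<Rightarrow> ('a \<Rightarrow> 'b::euclidean_space) \<Rightarrow> bool" where
  "Ck_on 0 S f \<longleftrightarrow> continuous_on S f"
| "Ck_on (Suc k) S f \<longleftrightarrow>
     (\<forall>x\<in>S. f differentiable (at x)) \<and>
     (\<forall>v. Ck_on k S (\<lambda>x. frechet_derivative f (at x) v))"

definition smooth_on :: "'a::euclidean_space set \<Rightarrow> ('a \<Rightarrow> 'b::euclidean_space) \<Rightarrow> bool" where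
  "smooth_on S f \<longleftrightarrow> (\<forall>k. Ck_on k S f)"

definition diffeomorphism_on ::
    "'a::euclidean_space set \<Rightarrow> 'b::euclidean_space set \<Rightarrow> ('a \<Rightarrow> 'b) \<Rightarrow> bool" where
  "diffeomorphism_on S T f \<longleftrightarrow>
     open S \<and> open T \<and> bij_betw f S T \<and> smooth_on S f \<and> smooth_on T (inv_into S f)"

text \<open>Lie groups whose underlying manifold is an open subset of a Euclidean space (a single global
  chart), which covers both groups considered here.\<close>

locale open_lie_group = group G for G :: "('a::euclidean_space, 'm) monoid_scheme" (structure) +
  assumes open_carrier: "open (carrier G)"
    and smooth_mult: "smooth_on (carrier G \<times> carrier G) (\<lambda>(g, h). g \<otimes> h)"
    and smooth_inv: "smooth_on (carrier G) (\<lambda>g. inv\<^bsub>G\<^esub> g)"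

definition contraction_by ::
    "('a::euclidean_space, 'm) monoid_scheme \<Rightarrow> ('b::euclidean_space, 'n) monoid_scheme \<Rightarrow>
     (real \<Rightarrow> 'a \<Rightarrow> 'b) \<Rightarrow> bool" where
  "contraction_by G0 G1 P \<longleftrightarrow>
     open_lie_group G0 \<and> open_lie_group G1 \<and>
     (\<forall>\<epsilon>\<in>{0<..1}. diffeomorphism_on (carrier G0) (carrier G1) (P \<epsilon>) \<and> P \<epsilon> \<one>\<^bsub>G0\<^esub> = \<one>\<^bsub>G1\<^esub>) \<and>
     (\<forall>g\<in>carrier G0. \<forall>h\<in>carrier G0.
        ((\<lambda>\<epsilon>. inv_into (carrier G0) (P \<epsilon>) (P \<epsilon> g \<otimes>\<^bsub>G1\<^esub> P \<epsilon> h)) \<longlongrightarrow> g \<otimes>\<^bsub>G0\<^esub> h) (at_right 0))"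

definition heisenberg :: "(real \<times> real \<times> real) monoid" where
  "heisenberg =
     \<lparr>carrier = UNIV,
      mult = (\<lambda>(x1, (y1, z1)) (x2, (y2, z2)). (x1 + x2, (y1 + y2 + x1 * z2, z1 + z2))),
      one = (0, (0, 0))\<rparr>"

definition extended_affine :: "(real \<times> real \<times> real) monoid" where
  "extended_affine =
     \<lparr>carrier = {0<..} \<times> UNIV \<times> UNIV,
      mult = (\<lambda>(\<alpha>, \<beta>, \<gamma>) (x, y, z). (\<alpha> * x, \<alpha> * y + \<beta>, \<gamma> + z)),
      one = (1, 0, 0)\<rparr>"

definition P_map :: "real \<Rightarrow> real \<times> real \<times> real \<Rightarrow> real \<times> real \<times> real" where
  "P_map \<epsilon> = (\<lambda>(x, (y, z)).
     if x \<noteq> 0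
     then (exp (- \<epsilon> * x),
           z * ((exp (- \<epsilon> * x) - 1) / (- \<epsilon> * x)),
           z + \<epsilon> * (y - x * z / 2))
     else (1, z, z + \<epsilon> * y))"

end

(* With \<phi>(t) = (exp t - 1) / t, extended by \<phi>(0) = 1, one has
   P_\<epsilon>(x, y, z) = (exp (-\<epsilon> x), z \<phi>(-\<epsilon> x), z + \<epsilon> (y - x z / 2)) without case distinction.
   Since \<phi> is an everywhere convergent power series and is positive, P_\<epsilon> has the smooth inverse
   (\<alpha>, \<beta>, \<gamma>) \<mapsto> (x, (\<gamma> - z) / \<epsilon> + x z / 2, z) with x = -ln \<alpha> / \<epsilon> and z = \<beta> / \<phi>(ln \<alpha>).
   Only the y-coordinate of the limit is delicate: there (\<gamma> - z) / \<epsilon> is a difference quotient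
   at \<epsilon> = 0, whose limit follows from \<phi>'(0) = 1/2. *)
theory Submission
  imports Defs
begin

section \<open>Calculus of \<open>Ck_on\<close>\<close>

declare Ck_on.simps(2) [simp del]

text \<open>Every point of an open \<open>S\<close> has a neighbourhood inside \<open>S\<close>, so
  agreement on \<open>S\<close> forces equal two-sided derivatives there, and the induction passes
  to them. It serves functions whose formula is known only on a carrier, such as inverses.\<close>

lemma Ck_on_cong:
  assumes "open S" "\<And>x. x \<in> S \<Longrightarrow> f x = g x" "Ck_on k S f"
  shows "Ck_on k S g"
  using assms(2,3)
proof (induction k arbitrary: f g)
  case 0
  then show ?case by (simp cong: continuous_on_cong)
next
  case (Suc k)
  have f: "f differentiable (at x)" if "x \<in> S" for x
    using Suc.prems(2) that by (simp add: Ck_on.simps(2))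
  have D: "(g has_derivative frechet_derivative f (at x)) (at x)" if "x \<in> S" for x
    by (rule has_derivative_transform_within_open[OF _ assms(1) that])
      (use f[OF that] frechet_derivative_works Suc.prems(1) in blast)+
  show ?case
    unfolding Ck_on.simps(2)
  proof (intro conjI ballI allI)
    show "g differentiable (at x)" if "x \<in> S" for x
      using D[OF that] by (rule differentiableI)
    show "Ck_on k S (\<lambda>x. frechet_derivative g (at x) v)" for v
    proof (rule Suc.IH)
      show "frechet_derivative f (at x) v = frechet_derivative g (at x) v" if "x \<in> S" for x
        by (rule fun_cong[OF frechet_derivative_at[OF D[OF that]]])
      show "Ck_on k S (\<lambda>x. frechet_derivative f (at x) v)"
        using Suc.prems(2) by (simp add: Ck_on.simps(2))
    qed
  qed
qed

text \<open>By uniqueness of the derivative, any explicit family \<open>f'\<close> can stand in for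
  the chosen \<open>frechet_derivative\<close>.\<close>

lemma Ck_on_SucI:
  assumes "open S" "\<And>x. x \<in> S \<Longrightarrow> (f has_derivative f' x) (at x)"
    and "\<And>v. Ck_on k S (\<lambda>x. f' x v)"
  shows "Ck_on (Suc k) S f"
proof -
  have "Ck_on k S (\<lambda>x. frechet_derivative f (at x) v)" for v
    by (rule Ck_on_cong[OF assms(1) _ assms(3)[of v]])
      (use frechet_derivative_at[OF assms(2)] in auto)
  with assms(2) show ?thesis by (auto simp: Ck_on.simps(2) differentiable_def)
qed

lemma Ck_on_SucE:
  assumes "Ck_on (Suc k) S f"
  obtains f' where "\<And>x. x \<in> S \<Longrightarrow> (f has_derivative f' x) (at x)"
    and "\<And>v. Ck_on k S (\<lambda>x. f' x v)"
  using assms that[of "\<lambda>x. frechet_derivative f (at x)"]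
  by (auto simp: Ck_on.simps(2) frechet_derivative_works[symmetric])

text \<open>The product and chain rules leave factors that are not differentiated; their order is
  lowered here to match that of the derivatives.\<close>

lemma Ck_on_SucD: "Ck_on (Suc k) S f \<Longrightarrow> Ck_on k S f"
proof (induction k arbitrary: f)
  case 0
  then show ?case
    by (auto simp: Ck_on.simps(2) intro!: continuous_at_imp_continuous_on differentiable_imp_continuous_within)
next
  case (Suc k)
  then show ?case by (metis Ck_on.simps(2))
qed

section \<open>Closure of \<open>Ck_on\<close> under linear maps, arithmetic and pairing\<close>

lemma Ck_on_const: "open S \<Longrightarrow> Ck_on k S (\<lambda>x. c)"
proof (induction k arbitrary: c)
  case (Suc k)
  show ?case
    by (rule Ck_on_SucI[where f' = "\<lambda>_ _. 0"]) (use Suc in auto)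
qed simp

lemma Ck_on_ident: "open S \<Longrightarrow> Ck_on k S (\<lambda>x. x)"
proof (cases k)
  case (Suc m)
  assume "open S"
  show ?thesis unfolding Suc
    by (rule Ck_on_SucI[where f' = "\<lambda>_ v. v"]) (use \<open>open S\<close> in \<open>auto intro: Ck_on_const\<close>)
qed (simp add: continuous_on_id)

text \<open>The derivative of \<open>L\<close> after \<open>f\<close> is \<open>L\<close> after
  \<open>f'\<close>, again of the same shape. The intended instances are the projections
  \<open>fst\<close> and \<open>snd\<close>.\<close>

lemma Ck_on_bounded_linear:
  assumes "bounded_linear L"
  shows "open S \<Longrightarrow> Ck_on k S f \<Longrightarrow> Ck_on k S (\<lambda>x. L (f x))"
proof (induction k arbitrary: f)
  case 0
  then show ?case using bounded_linear.continuous_on[OF assms] by auto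
next
  case (Suc k)
  obtain f' where f': "\<And>x. x \<in> S \<Longrightarrow> (f has_derivative f' x) (at x)" "\<And>v. Ck_on k S (\<lambda>x. f' x v)"
    using Suc.prems(2) by (rule Ck_on_SucE) blast
  show ?case
  proof (rule Ck_on_SucI)
    show "((\<lambda>x. L (f x)) has_derivative (\<lambda>v. L (f' x v))) (at x)" if "x \<in> S" for x
      using that by (intro bounded_linear.has_derivative[OF assms] f')
    show "Ck_on k S (\<lambda>x. L (f' x v))" for v
      by (rule Suc.IH[OF Suc.prems(1) f'(2)])
  qed (rule Suc.prems)
qed

lemmas Ck_on_fst = Ck_on_bounded_linear[OF bounded_linear_fst]
lemmas Ck_on_snd = Ck_on_bounded_linear[OF bounded_linear_snd]

lemma Ck_on_add:
  "open S \<Longrightarrow> Ck_on k S f \<Longrightarrow> Ck_on k S g \<Longrightarrow> Ck_on k S (\<lambda>x. f x + g x)"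
proof (induction k arbitrary: f g)
  case 0
  then show ?case by (auto intro: continuous_on_add)
next
  case (Suc k)
  obtain f' where f': "\<And>x. x \<in> S \<Longrightarrow> (f has_derivative f' x) (at x)" "\<And>v. Ck_on k S (\<lambda>x. f' x v)"
    using Suc.prems(2) by (rule Ck_on_SucE) blast
  obtain g' where g': "\<And>x. x \<in> S \<Longrightarrow> (g has_derivative g' x) (at x)" "\<And>v. Ck_on k S (\<lambda>x. g' x v)"
    using Suc.prems(3) by (rule Ck_on_SucE) blast
  show ?case
  proof (rule Ck_on_SucI)
    show "((\<lambda>x. f x + g x) has_derivative (\<lambda>v. f' x v + g' x v)) (at x)" if "x \<in> S" for x
      using that by (intro has_derivative_add f' g')
    show "Ck_on k S (\<lambda>x. f' x v + g' x v)" for v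
      by (rule Suc.IH[OF Suc.prems(1) f'(2) g'(2)])
  qed (rule Suc.prems(1))
qed

lemma Ck_on_mult:
  fixes f g :: "'a::euclidean_space \<Rightarrow> real"
  shows "open S \<Longrightarrow> Ck_on k S f \<Longrightarrow> Ck_on k S g \<Longrightarrow> Ck_on k S (\<lambda>x. f x * g x)"
proof (induction k arbitrary: f g)
  case 0
  then show ?case by (auto intro: continuous_on_mult)
next
  case (Suc k)
  obtain f' where f': "\<And>x. x \<in> S \<Longrightarrow> (f has_derivative f' x) (at x)" "\<And>v. Ck_on k S (\<lambda>x. f' x v)"
    using Suc.prems(2) by (rule Ck_on_SucE) blast
  obtain g' where g': "\<And>x. x \<in> S \<Longrightarrow> (g has_derivative g' x) (at x)" "\<And>v. Ck_on k S (\<lambda>x. g' x v)"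
    using Suc.prems(3) by (rule Ck_on_SucE) blast
  show ?case
  proof (rule Ck_on_SucI)
    show "((\<lambda>x. f x * g x) has_derivative (\<lambda>v. f x * g' x v + f' x v * g x)) (at x)" if "x \<in> S" for x
      using that by (intro has_derivative_mult f' g')
    show "Ck_on k S (\<lambda>x. f x * g' x v + f' x v * g x)" for v
      by (rule Ck_on_add[OF Suc.prems(1) Suc.IH[OF Suc.prems(1) _ g'(2)]
            Suc.IH[OF Suc.prems(1) f'(2)]]) (rule Ck_on_SucD, rule Suc.prems)+
  qed (rule Suc.prems(1))
qed

lemma Ck_on_minus:
  fixes f :: "'a::euclidean_space \<Rightarrow> real"
  shows "open S \<Longrightarrow> Ck_on k S f \<Longrightarrow> Ck_on k S (\<lambda>x. - f x)"
  using Ck_on_mult[OF _ Ck_on_const, of S k f "-1"] by simp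

lemma Ck_on_diff:
  fixes f g :: "'a::euclidean_space \<Rightarrow> real"
  shows "open S \<Longrightarrow> Ck_on k S f \<Longrightarrow> Ck_on k S g \<Longrightarrow> Ck_on k S (\<lambda>x. f x - g x)"
  using Ck_on_add[OF _ _ Ck_on_minus, of S k f g] by simp

lemma Ck_on_Pair:
  "open S \<Longrightarrow> Ck_on k S f \<Longrightarrow> Ck_on k S g \<Longrightarrow> Ck_on k S (\<lambda>x. (f x, g x))"
proof (induction k arbitrary: f g)
  case 0
  then show ?case by (auto intro: continuous_on_Pair)
next
  case (Suc k)
  obtain f' where f': "\<And>x. x \<in> S \<Longrightarrow> (f has_derivative f' x) (at x)" "\<And>v. Ck_on k S (\<lambda>x. f' x v)"
    using Suc.prems(2) by (rule Ck_on_SucE) blast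
  obtain g' where g': "\<And>x. x \<in> S \<Longrightarrow> (g has_derivative g' x) (at x)" "\<And>v. Ck_on k S (\<lambda>x. g' x v)"
    using Suc.prems(3) by (rule Ck_on_SucE) blast
  show ?case
  proof (rule Ck_on_SucI)
    show "((\<lambda>x. (f x, g x)) has_derivative (\<lambda>v. (f' x v, g' x v))) (at x)" if "x \<in> S" for x
      using that by (intro has_derivative_Pair f' g')
    show "Ck_on k S (\<lambda>x. (f' x v, g' x v))" for v
      by (rule Suc.IH[OF Suc.prems(1) f'(2) g'(2)])
  qed (rule Suc.prems(1))
qed

section \<open>Real functions of one variable and composition with them\<close>

lemma Ck_on_real_SucI:
  fixes f :: "real \<Rightarrow> real"
  assumes "open S" "\<And>x. x \<in> S \<Longrightarrow> (f has_real_derivative f' x) (at x)" "Ck_on k S f'"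
  shows "Ck_on (Suc k) S f"
proof (rule Ck_on_SucI[OF assms(1)])
  show "(f has_derivative (*) (f' x)) (at x)" if "x \<in> S" for x
    using assms(2)[OF that] unfolding has_field_derivative_def .
  show "Ck_on k S (\<lambda>x. f' x * v)" for v
    by (intro Ck_on_mult Ck_on_const assms)
qed

text \<open>A linear map on the reals is multiplication by its value at 1, which is therefore the
  scalar derivative.\<close>

lemma Ck_on_real_SucE:
  fixes f :: "real \<Rightarrow> real"
  assumes "Ck_on (Suc k) S f"
  obtains f' where "\<And>x. x \<in> S \<Longrightarrow> (f has_real_derivative f' x) (at x)" "Ck_on k S f'"
proof -
  obtain f' where f': "\<And>x. x \<in> S \<Longrightarrow> (f has_derivative f' x) (at x)" "\<And>v. Ck_on k S (\<lambda>x. f' x v)"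
    using assms by (rule Ck_on_SucE) blast
  have "(f has_real_derivative f' x 1) (at x)" if "x \<in> S" for x
  proof -
    interpret bounded_linear "f' x" by (rule has_derivative_bounded_linear[OF f'(1)[OF that]])
    have "f' x = (*) (f' x 1)"
    proof
      fix v
      show "f' x v = f' x 1 * v"
        using scaleR[of v 1] by (metis mult.commute mult.right_neutral real_scaleR_def)
    qed
    then show ?thesis
      unfolding has_field_derivative_def
      by (rule back_subst[of "\<lambda>h. (f has_derivative h) (at x)", OF f'(1)[OF that]])
  qed
  then show ?thesis by (rule that[OF _ f'(2)])
qed

text \<open>With a real outer function the chain rule yields a single product, closed under
  \<open>Ck_on_mult\<close>. The induction varies only \<open>g\<close>, replaced by
  \<open>g'\<close>, while \<open>f\<close> stays fixed.\<close>

lemma Ck_on_compose_real: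
  fixes g :: "real \<Rightarrow> real"
  shows "open S \<Longrightarrow> Ck_on k T g \<Longrightarrow> Ck_on k S f \<Longrightarrow> f ` S \<subseteq> T \<Longrightarrow> Ck_on k S (\<lambda>x. g (f x))"
proof (induction k arbitrary: g)
  case 0
  then show ?case by (auto intro: continuous_on_compose2)
next
  case (Suc k)
  obtain g' where g': "\<And>x. x \<in> T \<Longrightarrow> (g has_real_derivative g' x) (at x)" "Ck_on k T g'"
    using Suc.prems(2) by (rule Ck_on_real_SucE) blast
  obtain f' where f': "\<And>x. x \<in> S \<Longrightarrow> (f has_derivative f' x) (at x)" "\<And>v. Ck_on k S (\<lambda>x. f' x v)"
    using Suc.prems(3) by (rule Ck_on_SucE) blast
  show ?case
  proof (rule Ck_on_SucI)
    show "((\<lambda>x. g (f x)) has_derivative (\<lambda>v. g' (f x) * f' x v)) (at x)" if "x \<in> S" for x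
      using has_derivative_compose[OF f'(1)[OF that]] g'(1)[of "f x"] that Suc.prems(4)
      by (auto simp: has_field_derivative_def)
    show "Ck_on k S (\<lambda>x. g' (f x) * f' x v)" for v
      by (rule Ck_on_mult[OF Suc.prems(1) Suc.IH[OF Suc.prems(1) g'(2) _ Suc.prems(4)] f'(2)])
        (rule Ck_on_SucD, rule Suc.prems)
  qed (rule Suc.prems)
qed

lemma Ck_on_real_exp: "Ck_on k UNIV (exp :: real \<Rightarrow> real)"
proof (induction k)
  case (Suc k)
  then show ?case by (intro Ck_on_real_SucI[of _ _ exp]) auto
qed (simp add: continuous_on_exp[OF continuous_on_id])

text \<open>The derivative is a polynomial in \<open>inverse\<close> itself, so the induction
  hypothesis applies to the same function.\<close>

lemma Ck_on_real_inverse: "Ck_on k (- {0}) (inverse :: real \<Rightarrow> real)"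
proof (induction k)
  case 0
  then show ?case by (auto intro: continuous_on_inverse)
next
  case (Suc k)
  show ?case
    by (rule Ck_on_real_SucI[of _ _ "\<lambda>x. - (inverse x * inverse x)"])
      (use Suc in \<open>auto intro!: Ck_on_minus Ck_on_mult derivative_eq_intros simp: open_delete Compl_eq_Diff_UNIV\<close>)
qed

lemma Ck_on_real_ln: "Ck_on k {0<..} (ln :: real \<Rightarrow> real)"
proof (cases k)
  case 0
  then show ?thesis by (auto intro: continuous_on_ln)
next
  case (Suc m)
  show ?thesis unfolding Suc
  proof (rule Ck_on_real_SucI)
    show "Ck_on m {0<..} (inverse :: real \<Rightarrow> real)"
      \<comment> \<open>Composition with the identity acts as restriction from \<open>- {0}\<close>
        to \<open>{0<..}\<close>.\<close>
      by (rule Ck_on_compose_real[where f = "\<lambda>x. x", OF _ Ck_on_real_inverse])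
        (auto intro: Ck_on_ident)
  qed (auto intro!: derivative_eq_intros simp: field_simps)
qed

text \<open>Termwise differentiation gives another everywhere convergent series, with coefficients
  \<open>diffs c\<close>; hence the induction over all \<open>c\<close>.\<close>

lemma Ck_on_real_powser:
  fixes c :: "nat \<Rightarrow> real"
  assumes "\<And>x. summable (\<lambda>n. c n * x ^ n)"
  shows "Ck_on k UNIV (\<lambda>x. \<Sum>n. c n * x ^ n)"
  using assms
proof (induction k arbitrary: c)
  case 0
  have "isCont (\<lambda>x. \<Sum>n. c n * x ^ n) x" for x
    using termdiffs_strong_converges_everywhere[OF 0] DERIV_isCont by blast
  then show ?case by (simp add: continuous_at_imp_continuous_on)
next
  case (Suc k)
  show ?case
  proof (rule Ck_on_real_SucI)
    show "((\<lambda>x. \<Sum>n. c n * x ^ n) has_real_derivative (\<Sum>n. diffs c n * x ^ n)) (at x)" for x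
      by (rule termdiffs_strong_converges_everywhere[OF Suc.prems])
    show "Ck_on k UNIV (\<lambda>x. \<Sum>n. diffs c n * x ^ n)"
      by (rule Suc.IH[OF termdiff_converges_all[OF Suc.prems]])
  qed simp
qed

lemma Ck_on_divide:
  fixes f g :: "'a::euclidean_space \<Rightarrow> real"
  assumes "open S" "Ck_on k S f" "Ck_on k S g" "\<And>x. x \<in> S \<Longrightarrow> g x \<noteq> 0"
  shows "Ck_on k S (\<lambda>x. f x / g x)"
  unfolding divide_inverse
  by (intro Ck_on_mult Ck_on_compose_real[OF _ Ck_on_real_inverse]) (use assms in auto)

lemma Ck_on_exp:
  fixes f :: "'a::euclidean_space \<Rightarrow> real"
  shows "open S \<Longrightarrow> Ck_on k S f \<Longrightarrow> Ck_on k S (\<lambda>x. exp (f x))"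
  by (rule Ck_on_compose_real[OF _ Ck_on_real_exp]) auto

lemma Ck_on_ln:
  fixes f :: "'a::euclidean_space \<Rightarrow> real"
  shows "open S \<Longrightarrow> Ck_on k S f \<Longrightarrow> (\<And>x. x \<in> S \<Longrightarrow> f x > 0) \<Longrightarrow> Ck_on k S (\<lambda>x. ln (f x))"
  by (rule Ck_on_compose_real[OF _ Ck_on_real_ln]) auto

section \<open>The function \<open>(exp t - 1) / t\<close>\<close>

text \<open>This is the \<phi> of the introduction. The series form, unlike a case distinction,
  makes smoothness at 0 immediate.\<close>

definition exprel :: "real \<Rightarrow> real" where
  "exprel t = (\<Sum>n. inverse (fact (Suc n)) * t ^ n)"

text \<open>This is the exponential series with its constant term 1 removed, divided by
  \<open>t\<close>.\<close>

lemma sums_exprel: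
  fixes t :: real
  assumes "t \<noteq> 0"
  shows "(\<lambda>n. inverse (fact (Suc n)) * t ^ n) sums ((exp t - 1) / t)"
proof -
  have "(\<lambda>n. inverse (fact n) * t ^ n) sums exp t"
    using exp_converges[of t] by simp
  then have "(\<lambda>n. inverse (fact (Suc n)) * t ^ Suc n) sums (exp t - 1)"
    by (subst sums_Suc_iff) simp
  then have "(\<lambda>n. inverse (fact (Suc n)) * t ^ Suc n / t) sums ((exp t - 1) / t)"
    by (rule sums_divide)
  moreover have "inverse (fact (Suc n)) * t ^ Suc n / t = inverse (fact (Suc n)) * t ^ n" for n
    using assms by simp
  ultimately show ?thesis by (simp only:)
qed

lemma summable_exprel: "summable (\<lambda>n. inverse (fact (Suc n)) * t ^ n :: real)"
proof (cases "t = 0")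
  case True
  then show ?thesis by (auto intro!: summable_finite[of "{0}"])
next
  case False
  then show ?thesis using sums_exprel sums_summable by blast
qed

lemma exprel_nonzero: "t \<noteq> 0 \<Longrightarrow> exprel t = (exp t - 1) / t"
  using sums_exprel sums_unique unfolding exprel_def by force

lemma exprel_0 [simp]: "exprel 0 = 1"
  unfolding exprel_def by (subst powser_zero) simp

text \<open>For \<open>t\<close> other than 0, \<open>exp t - 1\<close> and \<open>t\<close> have
  the same sign. Hence division by \<open>exprel\<close> is always legitimate.\<close>

lemma exprel_pos: "exprel t > 0"
  by (cases "t = 0") (auto simp: exprel_nonzero zero_less_divide_iff)

lemma exprel_neq_0 [simp]: "exprel t \<noteq> 0"
  using exprel_pos[of t] by simp

lemma Ck_on_exprel:
  fixes f :: "'a::euclidean_space \<Rightarrow> real"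
  assumes "open S" "Ck_on k S f"
  shows "Ck_on k S (\<lambda>x. exprel (f x))"
proof (rule Ck_on_compose_real[where T = UNIV and g = exprel and f = f])
  show "Ck_on k UNIV exprel"
    unfolding exprel_def[abs_def] by (rule Ck_on_real_powser[OF summable_exprel])
qed (use assms in auto)

lemmas Ck_on_intros = Ck_on_const Ck_on_ident Ck_on_fst Ck_on_snd Ck_on_Pair Ck_on_add Ck_on_diff
  Ck_on_minus Ck_on_mult Ck_on_divide Ck_on_exp Ck_on_ln Ck_on_exprel

text \<open>The derivative at 0 is the coefficient of \<open>t\<close> in the series,
  \<open>inverse (fact 2)\<close>.\<close>

lemma exprel_deriv_0: "(exprel has_real_derivative 1 / 2) (at 0)"
proof -
  have "(exprel has_real_derivative (\<Sum>n. diffs (\<lambda>n. inverse (fact (Suc n))) n * 0 ^ n)) (at 0)"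
    unfolding exprel_def[abs_def]
    by (rule termdiffs_strong_converges_everywhere[OF summable_exprel])
  then show ?thesis by (subst (asm) powser_zero) (simp add: diffs_def)
qed

section \<open>The two Lie groups\<close>

lemma carrier_heisenberg [simp]: "carrier heisenberg = UNIV"
  and one_heisenberg [simp]: "\<one>\<^bsub>heisenberg\<^esub> = (0, 0, 0)"
  and mult_heisenberg [simp]:
    "(x1, y1, z1) \<otimes>\<^bsub>heisenberg\<^esub> (x2, y2, z2) = (x1 + x2, y1 + y2 + x1 * z2, z1 + z2)"
  by (simp_all add: heisenberg_def)

lemma carrier_extended_affine [simp]: "carrier extended_affine = {0<..} \<times> UNIV \<times> UNIV"
  and one_extended_affine [simp]: "\<one>\<^bsub>extended_affine\<^esub> = (1, 0, 0)"
  and mult_extended_affine [simp]: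
    "(\<alpha>, \<beta>, \<gamma>) \<otimes>\<^bsub>extended_affine\<^esub> (x, y, z) = (\<alpha> * x, \<alpha> * y + \<beta>, \<gamma> + z)"
  by (simp_all add: extended_affine_def)

lemma open_carrier_extended_affine: "open (carrier extended_affine)"
  unfolding carrier_extended_affine by (intro open_Times open_UNIV open_greaterThan)

lemma group_heisenberg: "group heisenberg"
proof (rule groupI)
  fix p :: "real \<times> real \<times> real"
  obtain x y z where p: "p = (x, y, z)" by (cases p)
  show "\<exists>q\<in>carrier heisenberg. q \<otimes>\<^bsub>heisenberg\<^esub> p = \<one>\<^bsub>heisenberg\<^esub>"
    \<comment> \<open>With first coordinate \<open>- x\<close>, the middle coordinate
      \<open>b\<close> must solve \<open>b + y + (- x) * z = 0\<close>.\<close>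
    by (rule bexI[of _ "(- x, x * z - y, - z)"]) (auto simp: p)
qed (auto simp: algebra_simps)

lemma group_extended_affine: "group extended_affine"
proof (rule groupI)
  fix p assume "p \<in> carrier extended_affine"
  then obtain x y z where p: "p = (x, y, z)" "x > 0" by auto
  show "\<exists>q\<in>carrier extended_affine. q \<otimes>\<^bsub>extended_affine\<^esub> p = \<one>\<^bsub>extended_affine\<^esub>"
    by (rule bexI[of _ "(1 / x, - y / x, - z)"]) (use p in auto)
qed (auto simp: algebra_simps)

lemma inv_heisenberg: "inv\<^bsub>heisenberg\<^esub> (x, y, z) = (- x, x * z - y, - z)"
  by (rule group.inv_equality[OF group_heisenberg]) auto

lemma inv_extended_affine: "x > 0 \<Longrightarrow> inv\<^bsub>extended_affine\<^esub> (x, y, z) = (1 / x, - y / x, - z)"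
  by (rule group.inv_equality[OF group_extended_affine]) auto

lemma open_lie_group_heisenberg: "open_lie_group heisenberg"
proof (intro open_lie_group.intro open_lie_group_axioms.intro group_heisenberg)
  \<comment> \<open>Tuple patterns are replaced by projections, the form that
    \<open>Ck_on_intros\<close> handles.\<close>
  have "(\<lambda>(g, h). g \<otimes>\<^bsub>heisenberg\<^esub> h) =
    (\<lambda>p. (fst (fst p) + fst (snd p),
          fst (snd (fst p)) + fst (snd (snd p)) + fst (fst p) * snd (snd (snd p)),
          snd (snd (fst p)) + snd (snd (snd p))))"
    by (auto simp: fun_eq_iff)
  then show "smooth_on (carrier heisenberg \<times> carrier heisenberg) (\<lambda>(g, h). g \<otimes>\<^bsub>heisenberg\<^esub> h)"
    unfolding smooth_on_def by (simp, intro allI Ck_on_intros) simp_all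
  have "(\<lambda>g. inv\<^bsub>heisenberg\<^esub> g) =
    (\<lambda>p. (- fst p, fst p * snd (snd p) - fst (snd p), - snd (snd p)))"
    by (auto simp: fun_eq_iff inv_heisenberg)
  then show "smooth_on (carrier heisenberg) (\<lambda>g. inv\<^bsub>heisenberg\<^esub> g)"
    unfolding smooth_on_def by (simp, intro allI Ck_on_intros) simp_all
qed auto

lemma open_lie_group_extended_affine: "open_lie_group extended_affine"
proof (intro open_lie_group.intro open_lie_group_axioms.intro group_extended_affine)
  let ?A = "carrier extended_affine"
  show open_A: "open ?A" by (rule open_carrier_extended_affine)
  have "(\<lambda>(g, h). g \<otimes>\<^bsub>extended_affine\<^esub> h) =
    (\<lambda>p. (fst (fst p) * fst (snd p),
          fst (fst p) * fst (snd (snd p)) + fst (snd (fst p)),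
          snd (snd (fst p)) + snd (snd (snd p))))"
    by (auto simp: fun_eq_iff)
  then show "smooth_on (?A \<times> ?A) (\<lambda>(g, h). g \<otimes>\<^bsub>extended_affine\<^esub> h)"
    unfolding smooth_on_def by (simp only:) (intro allI Ck_on_intros open_Times open_A)
  \<comment> \<open>The formula for the inverse is available only on the carrier, so
    \<open>Ck_on_cong\<close> replaces an equality of functions.\<close>
  have "Ck_on k ?A (\<lambda>g. inv\<^bsub>extended_affine\<^esub> g)" for k
  proof (rule Ck_on_cong[OF open_A])
    show "Ck_on k ?A (\<lambda>p. (1 / fst p, - fst (snd p) / fst p, - snd (snd p)))"
      by (intro Ck_on_intros open_A) auto
  qed (auto simp: inv_extended_affine)
  then show "smooth_on ?A (\<lambda>g. inv\<^bsub>extended_affine\<^esub> g)"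
    by (simp add: smooth_on_def)
qed

section \<open>The contraction\<close>

text \<open>Since \<epsilon> is positive, \<open>- \<epsilon> * x\<close> vanishes exactly when
  \<open>x\<close> does, so the case \<open>x = 0\<close> is absorbed by
  \<open>exprel 0 = 1\<close>.\<close>

lemma P_map_exprel:
  assumes "\<epsilon> > 0"
  shows "P_map \<epsilon> (x, y, z) = (exp (- \<epsilon> * x), z * exprel (- \<epsilon> * x), z + \<epsilon> * (y - x * z / 2))"
  using assms exprel_nonzero[of "- \<epsilon> * x"] by (cases "x = 0") (auto simp: P_map_def)

text \<open>The system is triangular: \<alpha> determines x, then \<beta> determines z, and \<gamma>
  finally determines y.\<close>

definition P_map_inv :: "real \<Rightarrow> real \<times> real \<times> real \<Rightarrow> real \<times> real \<times> real" where
  "P_map_inv \<epsilon> = (\<lambda>(\<alpha>, \<beta>, \<gamma>).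
     (- ln \<alpha> / \<epsilon>,
      (\<gamma> - \<beta> / exprel (ln \<alpha>)) / \<epsilon> + (- ln \<alpha> / \<epsilon>) * (\<beta> / exprel (ln \<alpha>)) / 2,
      \<beta> / exprel (ln \<alpha>)))"

lemma P_map_in_carrier: "\<epsilon> > 0 \<Longrightarrow> P_map \<epsilon> p \<in> carrier extended_affine"
  by (cases p) (auto simp: P_map_exprel)

lemma P_map_inv_P_map: "\<epsilon> > 0 \<Longrightarrow> P_map_inv \<epsilon> (P_map \<epsilon> p) = p"
  by (cases p) (auto simp: P_map_exprel P_map_inv_def field_simps)

lemma P_map_P_map_inv:
  assumes "\<epsilon> > 0" "q \<in> carrier extended_affine"
  shows "P_map \<epsilon> (P_map_inv \<epsilon> q) = q"
  using assms by (auto simp: P_map_exprel P_map_inv_def field_simps)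

text \<open>The left inverse makes \<open>P_map \<epsilon>\<close> injective, so the choice in
  \<open>inv_into\<close> can only return the explicit preimage.\<close>

lemma inv_into_P_map:
  assumes "\<epsilon> > 0" "q \<in> carrier extended_affine"
  shows "inv_into UNIV (P_map \<epsilon>) q = P_map_inv \<epsilon> q"
  using assms by (metis P_map_P_map_inv P_map_inv_P_map UNIV_I inv_into_f_eq inj_onI)

lemma diffeomorphism_P_map:
  assumes "\<epsilon> > 0"
  shows "diffeomorphism_on (carrier heisenberg) (carrier extended_affine) (P_map \<epsilon>)"
  unfolding diffeomorphism_on_def
proof (intro conjI)
  let ?A = "carrier extended_affine"
  show open_A: "open ?A" by (rule open_carrier_extended_affine)
  show "bij_betw (P_map \<epsilon>) (carrier heisenberg) ?A"
    by (rule bij_betw_byWitness[where f' = "P_map_inv \<epsilon>"])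
      (use P_map_in_carrier[OF assms] P_map_inv_P_map[OF assms] P_map_P_map_inv[OF assms]
        in \<open>simp_all add: image_subset_iff del: carrier_extended_affine\<close>)
  have "P_map \<epsilon> = (\<lambda>p. (exp (- \<epsilon> * fst p), snd (snd p) * exprel (- \<epsilon> * fst p),
      snd (snd p) + \<epsilon> * (fst (snd p) - fst p * snd (snd p) / 2)))"
    using assms by (auto simp: fun_eq_iff P_map_exprel)
  then show "smooth_on (carrier heisenberg) (P_map \<epsilon>)"
    unfolding smooth_on_def by (simp, intro allI Ck_on_intros) simp_all
  have "Ck_on k ?A (inv_into UNIV (P_map \<epsilon>))" for k
  proof (rule Ck_on_cong[OF open_A])
    show "Ck_on k ?A (P_map_inv \<epsilon>)"
      unfolding P_map_inv_def split_def by (intro Ck_on_intros open_A) (use assms in auto)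
  qed (use assms inv_into_P_map in auto)
  then show "smooth_on ?A (inv_into (carrier heisenberg) (P_map \<epsilon>))"
    by (simp add: smooth_on_def)
qed auto

section \<open>The limit of the transported product\<close>

lemma P_map_contraction_limit:
  "((\<lambda>\<epsilon>. inv_into UNIV (P_map \<epsilon>) (P_map \<epsilon> g \<otimes>\<^bsub>extended_affine\<^esub> P_map \<epsilon> h))
     \<longlongrightarrow> g \<otimes>\<^bsub>heisenberg\<^esub> h) (at_right 0)"
proof -
  obtain x1 y1 z1 where g: "g = (x1, y1, z1)" by (cases g)
  obtain x2 y2 z2 where h: "h = (x2, y2, z2)" by (cases h)
  define x where "x = x1 + x2"
  \<comment> \<open>Third coordinate of the product of the images of \<open>g\<close> and
    \<open>h\<close>.\<close>
  define \<gamma> where "\<gamma> \<epsilon> = z1 + z2 + \<epsilon> * (y1 + y2 - (x1 * z1 + x2 * z2) / 2)" for \<epsilon>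
  \<comment> \<open>The z-coordinate of the preimage of that product: its second coordinate divided
    by \<open>exprel\<close> of the logarithm of its first, which is
    \<open>- \<epsilon> * x\<close>.\<close>
  define \<zeta> where "\<zeta> \<epsilon> = (exp (- \<epsilon> * x1) * (z2 * exprel (- \<epsilon> * x2)) + z1 * exprel (- \<epsilon> * x1))
    / exprel (- \<epsilon> * x)" for \<epsilon>
  \<comment> \<open>The slope of \<gamma> minus the derivative of \<zeta> at 0.\<close>
  define D where "D = y1 + y2 - (x1 * z1 + x2 * z2) / 2 - (x2 * z1 - x1 * z2) / 2"
  have exprel_deriv: "((\<lambda>\<epsilon>. exprel (- \<epsilon> * a)) has_real_derivative - a / 2) (at 0)" for a
  proof -
    have "((\<lambda>\<epsilon>. - \<epsilon> * a) has_real_derivative - a) (at 0)"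
      by (auto intro!: derivative_eq_intros)
    with exprel_deriv_0 DERIV_chain2[of exprel "1 / 2" "\<lambda>\<epsilon>. - \<epsilon> * a" 0 "- a" UNIV]
    show ?thesis by simp
  qed
  \<comment> \<open>At 0 the denominator is 1 with derivative \<open>- x / 2\<close>, and the
    numerator is \<open>z1 + z2\<close> with derivative
    \<open>- x1 * z2 - (x1 * z1 + x2 * z2) / 2\<close>. In the quotient rule the terms
    \<open>x1 * z1\<close> and \<open>x2 * z2\<close> cancel.\<close>
  have \<zeta>_deriv: "(\<zeta> has_real_derivative (x2 * z1 - x1 * z2) / 2) (at 0)"
    unfolding \<zeta>_def[abs_def] x_def
    by (rule derivative_eq_intros exprel_deriv refl | simp)+ (simp add: field_simps)
  have "((\<lambda>\<epsilon>. \<gamma> \<epsilon> - \<zeta> \<epsilon>) has_real_derivative D) (at 0)"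
    unfolding \<gamma>_def[abs_def] D_def by (auto intro!: derivative_eq_intros \<zeta>_deriv)
  \<comment> \<open>Equal values at 0 turn the quotient by \<epsilon> into the difference quotient
    of \<open>\<gamma> \<epsilon> - \<zeta> \<epsilon>\<close>.\<close>
  moreover have \<zeta>_0: "\<zeta> 0 = z1 + z2" and "\<gamma> 0 = z1 + z2" by (simp_all add: \<zeta>_def \<gamma>_def)
  ultimately have "(\<lambda>\<epsilon>. (\<gamma> \<epsilon> - \<zeta> \<epsilon>) / \<epsilon>) \<midarrow>0\<rightarrow> D"
    by (simp add: DERIV_def)
  then have quotient: "((\<lambda>\<epsilon>. (\<gamma> \<epsilon> - \<zeta> \<epsilon>) / \<epsilon>) \<longlongrightarrow> D) (at_right 0)"
    by (rule filterlim_mono) (auto simp: at_le)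
  have "\<zeta> \<midarrow>0\<rightarrow> z1 + z2"
    using DERIV_isCont[OF \<zeta>_deriv] \<zeta>_0 by (simp add: isCont_def)
  then have \<zeta>_lim: "(\<zeta> \<longlongrightarrow> z1 + z2) (at_right 0)"
    by (rule filterlim_mono) (auto simp: at_le)
  have "((\<lambda>\<epsilon>. (x, (\<gamma> \<epsilon> - \<zeta> \<epsilon>) / \<epsilon> + x * \<zeta> \<epsilon> / 2, \<zeta> \<epsilon>))
      \<longlongrightarrow> (x, D + x * (z1 + z2) / 2, z1 + z2)) (at_right 0)"
    by (intro tendsto_intros quotient \<zeta>_lim) simp
  \<comment> \<open>Expanding \<open>x * (z1 + z2) / 2\<close> cancels every mixed term of
    \<open>D\<close> except \<open>x1 * z2 / 2\<close>, which it doubles to the twist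
    \<open>x1 * z2\<close> of the Heisenberg product.\<close>
  also have "(x, D + x * (z1 + z2) / 2, z1 + z2) = g \<otimes>\<^bsub>heisenberg\<^esub> h"
    by (simp add: g h x_def D_def field_simps)
  finally show ?thesis
  proof (rule Lim_transform_eventually)
    \<comment> \<open>The explicit preimage requires positive \<epsilon>, which is all that a limit
      from the right sees.\<close>
    have "(x, (\<gamma> \<epsilon> - \<zeta> \<epsilon>) / \<epsilon> + x * \<zeta> \<epsilon> / 2, \<zeta> \<epsilon>) =
        inv_into UNIV (P_map \<epsilon>) (P_map \<epsilon> g \<otimes>\<^bsub>extended_affine\<^esub> P_map \<epsilon> h)" if "\<epsilon> > 0" for \<epsilon>
    proof -
      have "P_map \<epsilon> g \<otimes>\<^bsub>extended_affine\<^esub> P_map \<epsilon> h =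
        (exp (- \<epsilon> * x), exp (- \<epsilon> * x1) * (z2 * exprel (- \<epsilon> * x2)) + z1 * exprel (- \<epsilon> * x1), \<gamma> \<epsilon>)"
        using that by (simp add: g h P_map_exprel x_def \<gamma>_def exp_add[symmetric] field_simps)
      with that show ?thesis
        by (simp add: inv_into_P_map P_map_inv_def \<zeta>_def)
    qed
    then show "\<forall>\<^sub>F \<epsilon> in at_right 0. (x, (\<gamma> \<epsilon> - \<zeta> \<epsilon>) / \<epsilon> + x * \<zeta> \<epsilon> / 2, \<zeta> \<epsilon>) =
        inv_into UNIV (P_map \<epsilon>) (P_map \<epsilon> g \<otimes>\<^bsub>extended_affine\<^esub> P_map \<epsilon> h)"
      by (auto simp: eventually_at_filter)
  qed
qed

theorem mainTheorem3: "contraction_by heisenberg extended_affine P_map"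
  unfolding contraction_by_def
  using open_lie_group_heisenberg open_lie_group_extended_affine diffeomorphism_P_map
    P_map_contraction_limit
  by (auto simp: P_map_exprel)

end
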